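(* Let $d,p\in\mathbb{N}$ with $d,p\ge 1$, let $\mathbf{n}=(n_1,\ldots,n_d)\in\mathbb{N}^d$ be a mode set with all $n_k\ge 1$, and put $N=n_1 n_2\cdots n_d$. Let $\mathbf{A}\in\mathbb{C}^{\mathbf{n}\times\mathbf{n}}$ be a tensor matrix, let $\mathbf{c}_0,\mathbf{c}_1,\ldots,\mathbf{c}_p\in\mathbb{C}^{\mathbf{n}}$ be tensors, and let $h\in\mathbb{R}$. Let $J_p\in\mathbb{C}^{p\times p}$ be the Jordan block with eigenvalue $0$ (ones on the first superdiagonal, zeros elsewhere), let $e_p=[0,\ldots,0,1]^T\in\mathbb{C}^p$, and define the block matrix $$\tilde{A}=\begin{bmatrix} -\operatorname{mat}(\mathbf{A}) & C\\ 0 & J_p\end{bmatrix}\in\mathbb{C}^{(N+p)\times(N+p)},\qquad C=[\operatorname{vec}(\mathbf{c}_p),\operatorname{vec}(\mathbf{c}_{p-1}),\ldots,\operatorname{vec}(\mathbf{c}_1)]\in\mathbb{C}^{N\times p}.$$ Then the vector formed by the first $N$ entries of $e^{h\tilde{A}}\begin{bmatrix}\operatorname{vec}(\mathbf{c}_0)\\ e_p\end{bmatrix}$ satisfies $$\left[e^{h\tilde{A}}\begin{bmatrix}\operatorname{vec}(\mathbf{c}_0)\\ e_p\end{bmatrix}\right]_{1:N}=\operatorname{vec}\left(\sum_{k=0}^{p}h^k\varphi_k(-h\mathbf{A})\,\mathbf{c}_k\right).$$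
   Context: A tensor with mode set $\mathbf{n}=(n_1,\ldots,n_d)$ is an array $\mathbf{T}\in\mathbb{C}^{\mathbf{n}}=\mathbb{C}^{n_1\times\cdots\times n_d}$ with entries $\mathbf{T}_{i_1,\ldots,i_d}$, $1\le i_k\le n_k$. A tensor matrix $\mathbf{A}\in\mathbb{C}^{\mathbf{n}\times\mathbf{n}}=\mathbb{C}^{n_1\times n_1\times\cdots\times n_d\times n_d}$ has entries $\mathbf{A}_{i_1,j_1,\ldots,i_d,j_d}$ and acts linearly on tensors by $$(\mathbf{A}\mathbf{T})_{i_1,\ldots,i_d}=\sum_{j_1=1}^{n_1}\cdots\sum_{j_d=1}^{n_d}\mathbf{A}_{i_1,j_1,\ldots,i_d,j_d}\mathbf{T}_{j_1,\ldots,j_d}.$$ Products and powers of tensor matrices are those of the corresponding linear maps on $\mathbb{C}^{\mathbf{n}}$, and $\mathbf{A}^0=\mathbf{I}_{\mathbf{n}}$ is the identity tensor matrix. Sums and scalar multiples are entrywise. Let $\psi_{\mathbf{n}}$ be the little-endian bijection from multi-indices to $\{1,\ldots,N\}$, $N=n_1\cdots n_d$, given by $\psi_{\mathbf{n}}(i_1,\ldots,i_d)=1+\sum_{k=1}^d (i_k-1)\prod_{l=1}^{k-1}n_l$. The vectorization $\operatorname{vec}(\mathbf{T})\in\mathbb{C}^N$ is defined by $\operatorname{vec}(\mathbf{T})_{\psi_{\mathbf{n}}(i_1,\ldots,i_d)}=\mathbf{T}_{i_1,\ldots,i_d}$. The matricization $\operatorname{mat}(\mathbf{A})\in\mathbb{C}^{N\times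 N}$ is defined by $\operatorname{mat}(\mathbf{A})_{\psi_{\mathbf{n}}(i_1,\ldots,i_d),\,\psi_{\mathbf{n}}(j_1,\ldots,j_d)}=\mathbf{A}_{i_1,j_1,\ldots,i_d,j_d}$. For $k\in\mathbb{N}_0$ the $\varphi$-functions are $\varphi_k(z)=\sum_{j=0}^{\infty}\frac{z^j}{(j+k)!}$, so $\varphi_0(z)=e^z$. For a tensor matrix $\mathbf{A}$ they are defined by the same convergent series, $\varphi_k(\mathbf{A})=\sum_{j=0}^{\infty}\frac{1}{(j+k)!}\mathbf{A}^j\in\mathbb{C}^{\mathbf{n}\times\mathbf{n}}$. For a square matrix $M$, $e^M$ denotes the usual matrix exponential. *)

theory Defs
  imports Complex_Main "Jordan_Normal_Form.Jordan_Normal_Form"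
begin

text \<open>
  The mode set is a list \<open>ns\<close> of variable length, so the order \<open>d\<close> and the modes \<open>n\<^sub>k\<close> are ordinary
  variables. Multi-indices are lists with 1-based entries; the list positions themselves are 0-based.
  A tensor is a function on multi-indices, of which only the values on \<open>multi_indices ns\<close> are ever
  used. The entry of a tensor matrix with the interleaved indices \<open>i\<^sub>1, j\<^sub>1, ..., i\<^sub>d, j\<^sub>d\<close> is \<open>A i j\<close>.
\<close>

type_synonym tensor = "nat list \<Rightarrow> complex"
type_synonym tensor_matrix = "nat list \<Rightarrow> nat list \<Rightarrow> complex"

definition multi_indices :: "nat list \<Rightarrow> nat list set" where
  "multi_indices ns = {i. length i = length ns \<and> (\<forall>k<length ns. 1 \<le> i ! k \<and> i ! k \<le> ns ! k)}"

definition tm_apply :: "nat list \<Rightarrow> tensor_matrix \<Rightarrow> tensor \<Rightarrow> tensor" where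
  "tm_apply ns A T = (\<lambda>i. \<Sum>j\<in>multi_indices ns. A i j * T j)"

definition tm_one :: tensor_matrix where
  "tm_one = (\<lambda>i j. if i = j then 1 else 0)"

definition tm_mult :: "nat list \<Rightarrow> tensor_matrix \<Rightarrow> tensor_matrix \<Rightarrow> tensor_matrix" where
  "tm_mult ns A B = (\<lambda>i j. \<Sum>l\<in>multi_indices ns. A i l * B l j)"

fun tm_power :: "nat list \<Rightarrow> tensor_matrix \<Rightarrow> nat \<Rightarrow> tensor_matrix" where
  "tm_power ns A 0 = tm_one"
| "tm_power ns A (Suc m) = tm_mult ns A (tm_power ns A m)"

definition tm_smult :: "complex \<Rightarrow> tensor_matrix \<Rightarrow> tensor_matrix" where
  "tm_smult a A = (\<lambda>i j. a * A i j)"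

text \<open>
  Convergence in the finite-dimensional space of tensor matrices is entrywise convergence; the series
  converges by \<open>summable_tm_phi\<close> below.
\<close>

definition tm_phi :: "nat list \<Rightarrow> nat \<Rightarrow> tensor_matrix \<Rightarrow> tensor_matrix" where
  "tm_phi ns k A = (\<lambda>i j. \<Sum>m. tm_power ns A m i j / fact (m + k))"

definition psi :: "nat list \<Rightarrow> nat list \<Rightarrow> nat" where
  "psi ns i = 1 + (\<Sum>k<length ns. (i ! k - 1) * (\<Prod>l<k. ns ! l))"

definition psi_inv :: "nat list \<Rightarrow> nat \<Rightarrow> nat list" where
  "psi_inv ns = the_inv_into (multi_indices ns) (psi ns)"

text \<open>
  Vectors and matrices of the library are indexed from 0, hence the shift by one. The defining
  equations in terms of \<open>psi\<close> are \<open>tvec_psi\<close> and \<open>tmat_psi\<close> below.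
\<close>

definition tvec :: "nat list \<Rightarrow> tensor \<Rightarrow> complex vec" where
  "tvec ns T = vec (prod_list ns) (\<lambda>r. T (psi_inv ns (r + 1)))"

definition tmat :: "nat list \<Rightarrow> tensor_matrix \<Rightarrow> complex mat" where
  "tmat ns A = mat (prod_list ns) (prod_list ns)
     (\<lambda>(r, s). A (psi_inv ns (r + 1)) (psi_inv ns (s + 1)))"

text \<open>The exponential of a square matrix; the entrywise series converges by \<open>summable_mat_exp\<close> below.\<close>

definition mat_exp :: "complex mat \<Rightarrow> complex mat" where
  "mat_exp M = mat (dim_row M) (dim_row M) (\<lambda>(r, s). \<Sum>m. (M ^\<^sub>m m) $$ (r, s) / fact m)"

definition augmented_mat :: "nat list \<Rightarrow> nat \<Rightarrow> tensor_matrix \<Rightarrow> (nat \<Rightarrow> tensor) \<Rightarrow> complex mat" where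
  "augmented_mat ns p A c =
     four_block_mat
       (- tmat ns A) (mat_of_cols (prod_list ns) (map (\<lambda>k. tvec ns (c k)) (rev [1..<p + 1])))
       (0\<^sub>m p (prod_list ns)) (jordan_block p 0)"

lemma multi_indices_Nil: "multi_indices [] = {[]}"
  by (auto simp: multi_indices_def)

lemma multi_indices_Cons:
  "multi_indices (n # ns) = (\<lambda>(a, i). a # i) ` ({1..n} \<times> multi_indices ns)"
proof (intro equalityI subsetI)
  fix x assume x: "x \<in> multi_indices (n # ns)"
  then obtain a i where xi: "x = a # i" by (cases x) (auto simp: multi_indices_def)
  have bnd: "1 \<le> x ! k \<and> x ! k \<le> (n # ns) ! k" if "k < Suc (length ns)" for k
    using x that by (simp add: multi_indices_def)
  have "a \<in> {1..n}" using bnd[of 0] xi by simp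
  moreover have "i \<in> multi_indices ns"
    using x xi bnd[of "Suc k" for k] by (auto simp: multi_indices_def)
  ultimately show "x \<in> (\<lambda>(a, i). a # i) ` ({1..n} \<times> multi_indices ns)" using xi by force
next
  fix x assume "x \<in> (\<lambda>(a, i). a # i) ` ({1..n} \<times> multi_indices ns)"
  then show "x \<in> multi_indices (n # ns)"
    by (auto simp: multi_indices_def nth_Cons split: nat.splits)
qed

lemma finite_multi_indices: "finite (multi_indices ns)"
  by (induction ns) (auto simp: multi_indices_Nil multi_indices_Cons)

lemma psi_Cons: "psi (n # ns) (a # i) = 1 + (a - 1) + n * (psi ns i - 1)"
proof -
  have "(\<Sum>k<Suc (length ns). ((a # i) ! k - 1) * (\<Prod>l<k. (n # ns) ! l))
      = (a - 1) + (\<Sum>k<length ns. (i ! k - 1) * (n * (\<Prod>l<k. ns ! l)))"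
    by (simp add: sum.lessThan_Suc_shift prod.lessThan_Suc_shift del: sum.lessThan_Suc prod.lessThan_Suc)
  then show ?thesis
    by (simp add: psi_def sum_distrib_left mult.left_commute)
qed

lemma psi_ge_1: "1 \<le> psi ns i"
  by (simp add: psi_def)

lemma bij_betw_psi: "bij_betw (psi ns) (multi_indices ns) {1..prod_list ns}"
proof (induction ns)
  case Nil
  then show ?case by (simp add: multi_indices_Nil psi_def bij_betw_def)
next
  case (Cons n ns)
  have inj: "inj_on (psi ns) (multi_indices ns)" and im: "psi ns ` multi_indices ns = {1..prod_list ns}"
    using Cons by (auto simp: bij_betw_def)
  have "inj_on (psi (n # ns)) (multi_indices (n # ns))"
  proof (rule inj_onI)
    fix x y assume "x \<in> multi_indices (n # ns)" "y \<in> multi_indices (n # ns)"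
      and eq: "psi (n # ns) x = psi (n # ns) y"
    then obtain a i b j where xy: "x = a # i" "y = b # j" "1 \<le> a" "a \<le> n" "1 \<le> b" "b \<le> n"
      "i \<in> multi_indices ns" "j \<in> multi_indices ns"
      by (auto simp: multi_indices_Cons)
    have e: "(a - 1) + n * (psi ns i - 1) = (b - 1) + n * (psi ns j - 1)"
      using eq xy by (simp add: psi_Cons)
    have "((a - 1) + n * (psi ns i - 1)) mod n = ((b - 1) + n * (psi ns j - 1)) mod n"
      using e by simp
    then have "(a - 1) mod n = (b - 1) mod n" by (simp only: mod_mult_self2)
    moreover have "a - 1 < n" "b - 1 < n" using xy by linarith+
    ultimately have ab: "a - 1 = b - 1" by simp
    have "n * (psi ns i - 1) = n * (psi ns j - 1)" using e unfolding ab by (simp only: add_left_cancel)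
    then have "psi ns i - 1 = psi ns j - 1" using xy by simp
    then have "psi ns i = psi ns j" using psi_ge_1[of ns i] psi_ge_1[of ns j] by linarith
    then have "i = j" using inj xy by (auto dest: inj_onD)
    with ab xy show "x = y" by simp
  qed
  moreover have "psi (n # ns) ` multi_indices (n # ns) = {1..prod_list (n # ns)}"
  proof (intro equalityI subsetI)
    fix r assume "r \<in> psi (n # ns) ` multi_indices (n # ns)"
    then obtain a i where r: "r = psi (n # ns) (a # i)" "1 \<le> a" "a \<le> n" "i \<in> multi_indices ns"
      by (auto simp: multi_indices_Cons)
    have "psi ns i \<in> {1..prod_list ns}" using im r(4) by blast
    then have "n * (psi ns i - 1) + n \<le> n * prod_list ns"
      by (metis atLeastAtMost_iff le_add_diff_inverse2 mult.right_neutral mult_le_mono2 distrib_left)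
    with r show "r \<in> {1..prod_list (n # ns)}" by (auto simp: psi_Cons)
  next
    fix r assume r: "r \<in> {1..prod_list (n # ns)}"
    then have n: "n > 0" by (cases n) auto
    have "(r - 1) div n < prod_list ns"
      using r n by (intro less_mult_imp_div_less) (auto simp: mult.commute)
    then have "(r - 1) div n + 1 \<in> psi ns ` multi_indices ns" using im by auto
    then obtain i where i: "i \<in> multi_indices ns" "psi ns i = (r - 1) div n + 1" by force
    have "psi (n # ns) (((r - 1) mod n + 1) # i) = r"
      using i r by (simp add: psi_Cons)
    moreover have "((r - 1) mod n + 1) # i \<in> multi_indices (n # ns)"
      using i n by (auto simp: multi_indices_Cons Suc_leI)
    ultimately show "r \<in> psi (n # ns) ` multi_indices (n # ns)" by (metis imageI)
  qed
  ultimately show ?case by (simp add: bij_betw_def)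
qed

lemma psi_inv_psi: "i \<in> multi_indices ns \<Longrightarrow> psi_inv ns (psi ns i) = i"
  using bij_betw_psi[of ns] by (simp add: psi_inv_def bij_betw_def the_inv_into_f_f)

lemma psi_less:
  assumes "i \<in> multi_indices ns"
  shows "psi ns i - 1 < prod_list ns" and "psi ns i - 1 + 1 = psi ns i"
proof -
  have "psi ns i \<in> {1..prod_list ns}"
    using bij_betw_psi[of ns] assms by (auto simp: bij_betw_def)
  then show "psi ns i - 1 < prod_list ns" "psi ns i - 1 + 1 = psi ns i" by auto
qed

lemma tvec_psi: "i \<in> multi_indices ns \<Longrightarrow> tvec ns T $ (psi ns i - 1) = T i"
  unfolding tvec_def by (simp only: index_vec psi_less psi_inv_psi)

lemma tmat_psi:
  "i \<in> multi_indices ns \<Longrightarrow> j \<in> multi_indices ns \<Longrightarrow>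
   tmat ns A $$ (psi ns i - 1, psi ns j - 1) = A i j"
  unfolding tmat_def by (simp only: index_mat(1) psi_less psi_inv_psi prod.case)

lemma tm_apply_one: "i \<in> multi_indices ns \<Longrightarrow> tm_apply ns tm_one T i = T i"
  by (simp add: tm_apply_def tm_one_def finite_multi_indices if_distrib[of "\<lambda>x. x * _"] cong: if_cong)

lemma tm_apply_mult: "tm_apply ns (tm_mult ns A B) T = tm_apply ns A (tm_apply ns B T)"
  unfolding tm_apply_def tm_mult_def
  by (simp add: sum_distrib_left sum_distrib_right mult.assoc) (rule ext, rule sum.swap)

lemma summable_tm_phi:
  assumes "i \<in> multi_indices ns" "j \<in> multi_indices ns"
  shows "summable (\<lambda>m. tm_power ns A m i j / fact (m + k))"
proof -
  define K where "K = (\<Sum>i\<in>multi_indices ns. \<Sum>j\<in>multi_indices ns. norm (A i j))"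
  have K0: "K \<ge> 0" by (auto simp: K_def intro!: sum_nonneg)
  have bnd: "norm (tm_power ns A m i j) \<le> K ^ m" if "i \<in> multi_indices ns" for m i
    using that
  proof (induction m arbitrary: i)
    case 0
    then show ?case by (simp add: tm_one_def)
  next
    case (Suc m)
    have "norm (tm_power ns A (Suc m) i j)
        \<le> (\<Sum>l\<in>multi_indices ns. norm (A i l) * norm (tm_power ns A m l j))"
      by (simp add: tm_mult_def norm_mult[symmetric] norm_sum)
    also have "\<dots> \<le> (\<Sum>l\<in>multi_indices ns. norm (A i l) * K ^ m)"
      using Suc.IH by (intro sum_mono mult_left_mono) auto
    also have "\<dots> = (\<Sum>l\<in>multi_indices ns. norm (A i l)) * K ^ m"
      by (simp add: sum_distrib_right)
    also have "\<dots> \<le> K * K ^ m"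
      unfolding K_def using Suc.prems K0
      by (intro mult_right_mono member_le_sum[where f = "\<lambda>i. \<Sum>l\<in>multi_indices ns. norm (A i l)"])
        (auto intro: sum_nonneg finite_multi_indices simp: K_def)
    finally show ?case by simp
  qed
  show ?thesis
  proof (rule summable_comparison_test'[where N = 0])
    show "summable (\<lambda>m. inverse (fact m) * K ^ m)" by (rule summable_exp)
    fix m
    have "norm (tm_power ns A m i j / fact (m + k)) \<le> K ^ m / fact m"
      unfolding norm_divide norm_fact
      using bnd[OF assms(1)] K0 by (intro frac_le) (auto intro: fact_mono)
    then show "norm (tm_power ns A m i j / fact (m + k)) \<le> inverse (fact m) * K ^ m"
      by (simp add: field_simps)
  qed
qed

lemma summable_mat_exp:
  fixes M :: "complex mat"
  assumes M: "M \<in> carrier_mat n n" and "r < n" "s < n"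
  shows "summable (\<lambda>m. (M ^\<^sub>m m) $$ (r, s) / fact m)"
proof -
  define K where "K = (\<Sum>s<n. \<Sum>l<n. norm (M $$ (l, s)))"
  have K0: "K \<ge> 0" by (auto simp: K_def intro!: sum_nonneg)
  have P: "M ^\<^sub>m m \<in> carrier_mat n n" for m using M by simp
  have bnd: "norm ((M ^\<^sub>m m) $$ (r, s)) \<le> K ^ m" if "s < n" for m s
    using that
  proof (induction m arbitrary: s)
    case 0
    then show ?case using M assms(2) by simp
  next
    case (Suc m)
    have "(M ^\<^sub>m Suc m) $$ (r, s) = (\<Sum>l<n. (M ^\<^sub>m m) $$ (r, l) * M $$ (l, s))"
      using M P[of m] assms(2) Suc.prems by (simp add: scalar_prod_def atLeast0LessThan)
    then have "norm ((M ^\<^sub>m Suc m) $$ (r, s))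
        \<le> (\<Sum>l<n. norm ((M ^\<^sub>m m) $$ (r, l)) * norm (M $$ (l, s)))"
      by (simp add: norm_mult[symmetric] norm_sum del: pow_mat.simps)
    also have "\<dots> \<le> (\<Sum>l<n. K ^ m * norm (M $$ (l, s)))"
      using Suc.IH by (intro sum_mono mult_right_mono) auto
    also have "\<dots> = K ^ m * (\<Sum>l<n. norm (M $$ (l, s)))"
      by (simp add: sum_distrib_left)
    also have "\<dots> \<le> K ^ m * K"
      unfolding K_def using Suc.prems K0
      by (intro mult_left_mono member_le_sum[where f = "\<lambda>s. \<Sum>l<n. norm (M $$ (l, s))"])
        (auto intro: sum_nonneg simp: K_def)
    finally show ?case by (simp add: mult.commute del: pow_mat.simps)
  qed
  show ?thesis
  proof (rule summable_comparison_test'[where N = 0])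
    show "summable (\<lambda>m. inverse (fact m) * K ^ m)" by (rule summable_exp)
    fix m
    show "norm ((M ^\<^sub>m m) $$ (r, s) / fact m) \<le> inverse (fact m) * K ^ m"
      using bnd[OF assms(3), of m] by (simp add: norm_divide norm_fact divide_right_mono field_simps)
  qed
qed

end

theory Submission
  imports Defs
begin

text \<open>
  Put \<open>w = (vec c\<^sub>0, e\<^sub>p)\<close> and \<open>B = -hA\<close>. The nilpotent block shifts \<open>e\<^sub>p\<close> down the Jordan chain, and
  each step feeds one more column of \<open>C\<close> into the first \<open>N\<close> entries, so the \<open>m\<close>-th power of
  the augmented matrix (times \<open>h\<close>) maps \<open>w\<close> to a vector whose first \<open>N\<close> entries are the vectorization
  of the sum of \<open>h\<^sup>k B\<^sup>m\<^sup>-\<^sup>k c\<^sub>k\<close> over \<open>k \<le> min m p\<close>. Dividing by \<open>m!\<close>, summing over \<open>m\<close> and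
  substituting \<open>j = m - k\<close> yields the series of \<open>\<phi>\<^sub>k(B)\<close>.
\<close>

lemma psi_inv_mem:
  assumes "r < prod_list ns"
  shows "psi_inv ns (r + 1) \<in> multi_indices ns"
  using assms bij_betw_psi[of ns]
  unfolding psi_inv_def bij_betw_def
  by (intro the_inv_into_into[OF _ _ subset_refl]) auto

lemma tvec_carrier: "tvec ns T \<in> carrier_vec (prod_list ns)"
  by (simp add: tvec_def)

lemma tmat_carrier: "tmat ns A \<in> carrier_mat (prod_list ns) (prod_list ns)"
  by (simp add: tmat_def)

text \<open>Outside \<open>multi_indices ns\<close> a tensor carries arbitrary values, so an
  identity such as \<open>tm_apply_one\<close> holds only on that set. Vectorization sees nothing
  else, and this turns such identities into equalities of vectors.\<close>

lemma tvec_cong: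
  assumes "\<And>i. i \<in> multi_indices ns \<Longrightarrow> S i = T i"
  shows "tvec ns S = tvec ns T"
  unfolding tvec_def using assms psi_inv_mem by (intro eq_vecI) auto

lemma tmat_mult_tvec: "tmat ns A *\<^sub>v tvec ns T = tvec ns (tm_apply ns A T)"
proof (rule eq_vecI)
  fix r assume "r < dim_vec (tvec ns (tm_apply ns A T))"
  then have r: "r < prod_list ns" by (simp add: tvec_def)
  \<comment> \<open>\<open>?f\<close> takes the 1-based position, while entries of vectors count
    from 0; hence \<open>?f (Suc s)\<close> below, before the sum is reindexed along
    \<open>psi ns\<close>.\<close>
  let ?f = "\<lambda>s. A (psi_inv ns (r + 1)) (psi_inv ns s) * T (psi_inv ns s)"
  have "(tmat ns A *\<^sub>v tvec ns T) $ r = (\<Sum>s<prod_list ns. ?f (Suc s))"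
    using r by (simp add: tmat_def tvec_def scalar_prod_def atLeast0LessThan)
  also have "\<dots> = (\<Sum>s\<in>{1..prod_list ns}. ?f s)"
    using sum.atLeast1_atMost_eq[of ?f "prod_list ns"] by simp
  also have "\<dots> = (\<Sum>j\<in>multi_indices ns. ?f (psi ns j))"
    by (rule sum.reindex_bij_betw[OF bij_betw_psi, symmetric])
  also have "\<dots> = (\<Sum>j\<in>multi_indices ns. A (psi_inv ns (r + 1)) j * T j)"
    by (intro sum.cong) (auto simp: psi_inv_psi)
  finally show "(tmat ns A *\<^sub>v tvec ns T) $ r = tvec ns (tm_apply ns A T) $ r"
    using r by (simp add: tvec_def tm_apply_def)
qed (simp add: tmat_def tvec_def)

text \<open>The recursion of the matrix power puts the new factor on the right, where it meets
  \<open>F k\<close> first and moves it to \<open>F (Suc k)\<close>; the induction therefore needs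
  all \<open>k\<close>.\<close>

lemma pow_mat_mult_orbit:
  fixes M :: "'a :: comm_semiring_1 mat"
  assumes M: "M \<in> carrier_mat n n"
    and F: "\<And>m. F m \<in> carrier_vec n" "\<And>m. M *\<^sub>v F m = F (Suc m)"
  shows "M ^\<^sub>m m *\<^sub>v F k = F (k + m)"
proof (induction m arbitrary: k)
  case 0
  then show ?case using M F(1)[of k] by simp
next
  case (Suc m)
  have "M ^\<^sub>m Suc m *\<^sub>v F k = M ^\<^sub>m m *\<^sub>v (M *\<^sub>v F k)"
    using assoc_mult_mat_vec[OF pow_carrier_mat[OF M] M F(1)] by simp
  then show ?case using Suc.IH[of "Suc k"] F(2) by simp
qed

text \<open>Applying a matrix is a finite sum in each row, so it commutes with the entrywise
  series.\<close>

lemma mat_exp_mult_vec_sums: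
  assumes M: "M \<in> carrier_mat n n" and v: "v \<in> carrier_vec n" and r: "r < n"
  shows "(\<lambda>m. (M ^\<^sub>m m *\<^sub>v v) $ r / fact m) sums (mat_exp M *\<^sub>v v) $ r"
proof -
  have "(\<lambda>m. \<Sum>s<n. (M ^\<^sub>m m) $$ (r, s) / fact m * v $ s) sums
      (\<Sum>s<n. (\<Sum>m. (M ^\<^sub>m m) $$ (r, s) / fact m) * v $ s)"
    using summable_mat_exp[OF M r] by (intro sums_sum sums_mult2 summable_sums) auto
  moreover have "(M ^\<^sub>m m *\<^sub>v v) $ r / fact m = (\<Sum>s<n. (M ^\<^sub>m m) $$ (r, s) / fact m * v $ s)" for m
  proof -
    have "(P *\<^sub>v v) $ r / fact m = (\<Sum>s<n. P $$ (r, s) / fact m * v $ s)"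
      if "P \<in> carrier_mat n n" for P
      using that v r by (simp add: scalar_prod_def atLeast0LessThan sum_divide_distrib)
    then show ?thesis using pow_carrier_mat[OF M] by blast
  qed
  moreover have "(mat_exp M *\<^sub>v v) $ r = (\<Sum>s<n. (\<Sum>m. (M ^\<^sub>m m) $$ (r, s) / fact m) * v $ s)"
    using M v r by (simp add: mat_exp_def scalar_prod_def atLeast0LessThan)
  ultimately show ?thesis by simp
qed

lemma tm_apply_phi_sums:
  assumes "i \<in> multi_indices ns"
  shows "(\<lambda>m. tm_apply ns (tm_power ns A m) T i / fact (m + k)) sums tm_apply ns (tm_phi ns k A) T i"
proof -
  have "(\<lambda>m. \<Sum>j\<in>multi_indices ns. tm_power ns A m i j / fact (m + k) * T j) sums
      (\<Sum>j\<in>multi_indices ns. tm_phi ns k A i j * T j)"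
    unfolding tm_phi_def using summable_tm_phi[OF assms]
    by (intro sums_sum sums_mult2 summable_sums) auto
  then show ?thesis by (simp add: tm_apply_def sum_divide_distrib)
qed

lemma tm_apply_smult: "tm_apply ns (tm_smult a A) T i = a * tm_apply ns A T i"
  by (simp add: tm_apply_def tm_smult_def sum_distrib_left mult.assoc)

lemma tm_apply_sum:
  "tm_apply ns A (\<lambda>i. \<Sum>k\<in>K. a k * T k i) i = (\<Sum>k\<in>K. a k * tm_apply ns A (T k) i)"
  unfolding tm_apply_def sum_distrib_left by (subst sum.swap) (simp add: mult.left_commute)

lemma smult_mat_mult_vec:
  fixes A :: "'a :: comm_semiring_0 mat"
  assumes "A \<in> carrier_mat nr nc" "v \<in> carrier_vec nc"
  shows "(a \<cdot>\<^sub>m A) *\<^sub>v v = a \<cdot>\<^sub>v (A *\<^sub>v v)"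
  using assms by (intro eq_vecI) auto

lemma mat_of_cols_mult_unit_vec:
  fixes vs :: "'a :: semiring_1 vec list"
  assumes "q < length vs" "vs ! q \<in> carrier_vec n"
  shows "mat_of_cols n vs *\<^sub>v unit_vec (length vs) q = vs ! q"
  using assms by (intro eq_vecI) (auto simp: mat_of_cols_index)

lemma jordan_block_zero_mult_unit_vec:
  assumes "q < p"
  shows "jordan_block p 0 *\<^sub>v unit_vec p q =
    (if q = 0 then 0\<^sub>v p else unit_vec p (q - 1) :: 'a :: comm_semiring_1 vec)"
  using assms by (intro eq_vecI) (auto simp: jordan_block_def)

text \<open>
  With 1-based indices, \<open>chain_vec p m\<close> is \<open>e\<^bsub>p-m\<^esub>\<close>, read as zero for \<open>m \<ge> p\<close>. The case distinction
  keeps the truncated \<open>p - 1 - m\<close> from returning the first unit vector there.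
\<close>
definition chain_vec :: "nat \<Rightarrow> nat \<Rightarrow> complex vec" where
  "chain_vec p m = (if m < p then unit_vec p (p - 1 - m) else 0\<^sub>v p)"

text \<open>The range of \<open>k\<close> does not depend on \<open>m\<close>, so that the sum can
  be exchanged with the series over \<open>m\<close>. The coefficient is zero for
  \<open>k > m\<close>, where \<open>m - k\<close> is truncated.\<close>

definition orbit_tensor ::
    "nat list \<Rightarrow> nat \<Rightarrow> tensor_matrix \<Rightarrow> (nat \<Rightarrow> tensor) \<Rightarrow> complex \<Rightarrow> nat \<Rightarrow> tensor" where
  "orbit_tensor ns p B c z m =
    (\<lambda>i. \<Sum>k=0..p. (if k \<le> m then z ^ k else 0) * tm_apply ns (tm_power ns B (m - k)) (c k) i)"

lemma orbit_tensor_0: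
  assumes "i \<in> multi_indices ns"
  shows "orbit_tensor ns p B c z 0 i = c 0 i"
  using assms by (simp add: orbit_tensor_def tm_apply_one if_distrib[of "\<lambda>x. x * _"] cong: if_cong)

text \<open>Each term with \<open>k \<le> m\<close> gains one factor \<open>B\<close>. The term
  \<open>k = Suc m\<close> is new, has power 0, and lies in the range only if
  \<open>m < p\<close>.\<close>

lemma orbit_tensor_Suc:
  assumes "i \<in> multi_indices ns"
  shows "orbit_tensor ns p B c z (Suc m) i =
    tm_apply ns B (orbit_tensor ns p B c z m) i + (if m < p then z ^ Suc m * c (Suc m) i else 0)"
proof -
  have "orbit_tensor ns p B c z (Suc m) i =
      (\<Sum>k=0..p. (if k \<le> m then z ^ k else 0) * tm_apply ns B (tm_apply ns (tm_power ns B (m - k)) (c k)) i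
        + (if k = Suc m then z ^ k * c k i else 0))"
    unfolding orbit_tensor_def using assms
    by (intro sum.cong) (auto simp: le_Suc_eq Suc_diff_le tm_apply_mult tm_apply_one)
  then show ?thesis by (auto simp: sum.distrib orbit_tensor_def tm_apply_sum)
qed

lemma augmented_mat_carrier:
  "augmented_mat ns p A c \<in> carrier_mat (prod_list ns + p) (prod_list ns + p)"
  unfolding augmented_mat_def by (intro four_block_carrier_mat) (auto simp: tmat_def)

lemma chain_vec_carrier: "chain_vec p m \<in> carrier_vec p"
  by (simp add: chain_vec_def)

lemma jordan_block_mult_chain_vec:
  "jordan_block p 0 *\<^sub>v chain_vec p m = chain_vec p (Suc m)"
  by (auto simp: chain_vec_def jordan_block_zero_mult_unit_vec Suc_diff_Suc)

lemma coefficient_cols_carrier: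
  "mat_of_cols (prod_list ns) (map (\<lambda>k. tvec ns (c k)) (rev [1..<p + 1]))
    \<in> carrier_mat (prod_list ns) p"
  by (intro carrier_matI) (simp_all del: upt_Suc)

lemma coefficient_cols_mult_chain_vec:
  "mat_of_cols (prod_list ns) (map (\<lambda>k. tvec ns (c k)) (rev [1..<p + 1])) *\<^sub>v chain_vec p m =
    (if m < p then tvec ns (c (Suc m)) else 0\<^sub>v (prod_list ns))"
proof (cases "m < p")
  case True
  let ?vs = "map (\<lambda>k. tvec ns (c k)) (rev [1..<p + 1])"
  \<comment> \<open>The columns run from \<open>c p\<close> down to \<open>c 1\<close>, so the one
    at 0-based position \<open>q\<close> comes from \<open>c (p - q)\<close>.\<close>
  have "?vs ! (p - 1 - m) = tvec ns (c (Suc m))" using True by (simp add: rev_nth del: upt_Suc)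
  with True mat_of_cols_mult_unit_vec[of "p - 1 - m" ?vs "prod_list ns"] show ?thesis
    by (simp add: chain_vec_def tvec_carrier del: upt_Suc)
next
  case False
  then show ?thesis
    using coefficient_cols_carrier[of ns c p] by (auto simp: chain_vec_def simp del: upt_Suc)
qed

text \<open>The factor \<open>z\<close> and the minus sign of the upper left block combine to
  \<open>B\<close>. The weight \<open>z ^ m\<close> on the chain vector makes the column that enters
  at this step arrive as \<open>z ^ Suc m * c (Suc m)\<close>, the new term in
  \<open>orbit_tensor_Suc\<close>.\<close>

lemma augmented_mat_mult_orbit:
  fixes z :: complex and A :: tensor_matrix
  defines "B \<equiv> tm_smult (- z) A"
  shows "(z \<cdot>\<^sub>m augmented_mat ns p A c) *\<^sub>v
      (tvec ns (orbit_tensor ns p B c z m) @\<^sub>v z ^ m \<cdot>\<^sub>v chain_vec p m) =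
    tvec ns (orbit_tensor ns p B c z (Suc m)) @\<^sub>v z ^ Suc m \<cdot>\<^sub>v chain_vec p (Suc m)"
proof -
  let ?N = "prod_list ns" and ?T = "orbit_tensor ns p B c z m"
  let ?C = "mat_of_cols ?N (map (\<lambda>k. tvec ns (c k)) (rev [1..<p + 1]))"
  let ?u = "tvec ns ?T" and ?v = "z ^ m \<cdot>\<^sub>v chain_vec p m"
  have C: "?C \<in> carrier_mat ?N p" by (rule coefficient_cols_carrier)
  have v: "?v \<in> carrier_vec p" by (simp add: chain_vec_carrier)
  have "augmented_mat ns p A c *\<^sub>v (?u @\<^sub>v ?v) =
      (- tmat ns A *\<^sub>v ?u + ?C *\<^sub>v ?v) @\<^sub>v (0\<^sub>m p ?N *\<^sub>v ?u + jordan_block p 0 *\<^sub>v ?v)"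
    unfolding augmented_mat_def
    using C v tmat_carrier tvec_carrier by (intro four_block_mat_mult_vec) auto
  also have "- tmat ns A *\<^sub>v ?u + ?C *\<^sub>v ?v =
      - tvec ns (tm_apply ns A ?T) +
      z ^ m \<cdot>\<^sub>v (if m < p then tvec ns (c (Suc m)) else 0\<^sub>v ?N)"
    using mult_mat_vec[OF C chain_vec_carrier] coefficient_cols_mult_chain_vec[of ns c p m]
      uminus_mult_mat_vec[of ?u "tmat ns A"] tmat_carrier[of ns A] tvec_carrier[of ns ?T]
    by (simp add: tmat_mult_tvec)
  also have "0\<^sub>m p ?N *\<^sub>v ?u + jordan_block p 0 *\<^sub>v ?v = z ^ m \<cdot>\<^sub>v chain_vec p (Suc m)"
  proof -
    have "0\<^sub>m p ?N *\<^sub>v ?u = 0\<^sub>v p"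
      using tvec_carrier[of ns ?T] by (intro eq_vecI) auto
    then show ?thesis
      using mult_mat_vec[OF jordan_block_carrier chain_vec_carrier, of p 0 "z ^ m" m]
        chain_vec_carrier[of p "Suc m"]
      by (simp add: jordan_block_mult_chain_vec)
  qed
  finally have block: "augmented_mat ns p A c *\<^sub>v (?u @\<^sub>v ?v) =
      (- tvec ns (tm_apply ns A ?T) + z ^ m \<cdot>\<^sub>v (if m < p then tvec ns (c (Suc m)) else 0\<^sub>v ?N))
      @\<^sub>v z ^ m \<cdot>\<^sub>v chain_vec p (Suc m)" .
  have uv: "?u @\<^sub>v ?v \<in> carrier_vec (?N + p)" using v tvec_carrier by simp
  have top: "tvec ns (orbit_tensor ns p B c z (Suc m)) =
      z \<cdot>\<^sub>v (- tvec ns (tm_apply ns A ?T) + z ^ m \<cdot>\<^sub>v (if m < p then tvec ns (c (Suc m)) else 0\<^sub>v ?N))"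
  proof (rule eq_vecI)
    fix r assume "r < dim_vec (z \<cdot>\<^sub>v (- tvec ns (tm_apply ns A ?T) +
      z ^ m \<cdot>\<^sub>v (if m < p then tvec ns (c (Suc m)) else 0\<^sub>v ?N)))"
    then have "r < ?N" by (simp add: tvec_def split: if_splits)
    with orbit_tensor_Suc[OF psi_inv_mem[OF this], of p B c z m]
    show "tvec ns (orbit_tensor ns p B c z (Suc m)) $ r = (z \<cdot>\<^sub>v (- tvec ns (tm_apply ns A ?T) +
        z ^ m \<cdot>\<^sub>v (if m < p then tvec ns (c (Suc m)) else 0\<^sub>v ?N))) $ r"
      by (simp add: tvec_def B_def tm_apply_smult algebra_simps)
  qed (simp add: tvec_def)
  show ?thesis
    unfolding smult_mat_mult_vec[OF augmented_mat_carrier uv] block top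
    by (intro eq_vecI) (auto simp: tvec_def chain_vec_def)
qed

theorem mainTheorem1:
  fixes d p :: nat and ns :: "nat list"
    and A :: tensor_matrix and c :: "nat \<Rightarrow> tensor" and h :: real
  assumes "d \<ge> 1" and "p \<ge> 1"
    and "length ns = d" and "\<forall>k<d. ns ! k \<ge> 1"
  shows "vec_first
           (mat_exp (complex_of_real h \<cdot>\<^sub>m augmented_mat ns p A c)
              *\<^sub>v (tvec ns (c 0) @\<^sub>v unit_vec p (p - 1)))
           (prod_list ns)
       = tvec ns (\<lambda>i. \<Sum>k=0..p. complex_of_real h ^ k *
           tm_apply ns (tm_phi ns k (tm_smult (- complex_of_real h) A)) (c k) i)"
proof (rule eq_vecI)
  let ?N = "prod_list ns" and ?z = "complex_of_real h"
  let ?M = "?z \<cdot>\<^sub>m augmented_mat ns p A c" and ?B = "tm_smult (- ?z) A"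
  let ?R = "tvec ns (\<lambda>i. \<Sum>k=0..p. ?z ^ k * tm_apply ns (tm_phi ns k ?B) (c k) i)"
  let ?a = "orbit_tensor ns p ?B c ?z"
  let ?F = "\<lambda>m. tvec ns (?a m) @\<^sub>v ?z ^ m \<cdot>\<^sub>v chain_vec p m"
  have M: "?M \<in> carrier_mat (?N + p) (?N + p)" by (simp add: augmented_mat_carrier)
  have F: "?F m \<in> carrier_vec (?N + p)" for m by (simp add: tvec_carrier chain_vec_carrier)
  \<comment> \<open>Since \<open>p \<ge> 1\<close>, the chain starts at the last unit
    vector.\<close>
  have F0: "?F 0 = tvec ns (c 0) @\<^sub>v unit_vec p (p - 1)"
    using \<open>p \<ge> 1\<close> tvec_cong[of ns "?a 0" "c 0"] by (simp add: orbit_tensor_0 chain_vec_def)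
  fix r assume "r < dim_vec ?R"
  then have r: "r < ?N" by (simp add: tvec_def)
  define i where "i = psi_inv ns (r + 1)"
  have i: "i \<in> multi_indices ns" using psi_inv_mem[OF r] by (simp add: i_def)
  have "(\<lambda>m. (?M ^\<^sub>m m *\<^sub>v ?F 0) $ r / fact m) sums (mat_exp ?M *\<^sub>v ?F 0) $ r"
    using r by (intro mat_exp_mult_vec_sums[OF M F]) simp
  moreover have "(?M ^\<^sub>m m *\<^sub>v ?F 0) $ r = ?a m i" for m
    using pow_mat_mult_orbit[where F = ?F, OF M F augmented_mat_mult_orbit, of m 0] r
    by (simp add: tvec_def i_def)
  ultimately have "(\<lambda>m. ?a m i / fact m) sums (mat_exp ?M *\<^sub>v ?F 0) $ r"
    by simp
  moreover have "(\<lambda>m. ?a m i / fact m) sums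
      (\<Sum>k=0..p. ?z ^ k * tm_apply ns (tm_phi ns k ?B) (c k) i)"
  proof -
    \<comment> \<open>The terms with \<open>m < k\<close> vanish. Shifting by \<open>k\<close> turns
      \<open>fact m\<close> into \<open>fact (m + k)\<close>, the denominator in \<phi>_k.\<close>
    have "(\<lambda>m. (if k \<le> m then ?z ^ k else 0) * tm_apply ns (tm_power ns ?B (m - k)) (c k) i / fact m)
        sums (?z ^ k * tm_apply ns (tm_phi ns k ?B) (c k) i)" for k
      using sums_mult[OF tm_apply_phi_sums[OF i, of ?B "c k" k], of "?z ^ k"]
      by (subst sums_zero_iff_shift[of k, symmetric]) auto
    then show ?thesis unfolding orbit_tensor_def sum_divide_distrib by (intro sums_sum)
  qed
  ultimately have "(mat_exp ?M *\<^sub>v ?F 0) $ r =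
      (\<Sum>k=0..p. ?z ^ k * tm_apply ns (tm_phi ns k ?B) (c k) i)"
    by (rule sums_unique2)
  then show "vec_first (mat_exp ?M *\<^sub>v (tvec ns (c 0) @\<^sub>v unit_vec p (p - 1))) ?N $ r = ?R $ r"
    using r unfolding F0 by (simp add: vec_first_def tvec_def i_def)
qed (simp add: tvec_def)

end
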